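(* The algorithm Random Walk Threshold (described in the context), applied to a graph with $n$ vertices and maximal vertex degree $d_{\max}$, requires $O(n d_{\max} t+n\log(n))$ operations, where $t$ is the depth of the random walk.
   Context: $G$ is an undirected graph on $V=[n]$ with adjacency matrix $A$, $D=\mathrm{diag}(d_1,\dots,d_n)$ is the diagonal matrix of vertex degrees, and $d_{\max}=\max_i d_i$. $\mathbf 1_\Gamma\in\mathbb R^n$ is the indicator vector of $\Gamma\subset V$. Random Walk Threshold (input: $A$, $\delta\in(0,1)$, a set of seed vertices $\Gamma\subset C_1$ of a target cluster $C_1\subset V$, estimated size $\hat n_1\approx|C_1|$, depth $t\in\mathbb Z^+$): (1) compute $P=AD^{-1}$ and $\mathbf v^{(0)}=D\mathbf 1_\Gamma$; (2) compute $\mathbf v^{(t)}=P^t\mathbf v^{(0)}$; (3) let $\Omega$ be the set of indices of the $(1+\delta)\hat n_1$ largest entries of $\mathbf v^{(t)}$; output $\Omega\cup\Gamma$. *)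

theory Defs
  imports Complex_Main "HOL-Library.Monad_Syntax" "Jordan_Normal_Form.Matrix"
begin

section \<open>The algorithm as a mathematical specification\<close>

text \<open>The vertex set is \<open>{..<n}\<close>; an edge is a two-element set of vertices.\<close>

definition simple_graph :: "nat \<Rightarrow> nat set set \<Rightarrow> bool" where
  "simple_graph n E \<longleftrightarrow> E \<subseteq> {{u, v} | u v. u < n \<and> v < n \<and> u \<noteq> v}"

definition degree :: "nat set set \<Rightarrow> nat \<Rightarrow> nat" where
  "degree E i = card {j. {i, j} \<in> E}"

definition max_degree :: "nat \<Rightarrow> nat set set \<Rightarrow> nat" where
  "max_degree n E = Max (degree E ` {..<n})"

definition adjacency_matrix :: "nat \<Rightarrow> nat set set \<Rightarrow> real mat" where
  "adjacency_matrix n E = mat n n (\<lambda>(i, j). if {i, j} \<in> E then 1 else 0)"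

definition degree_matrix :: "nat \<Rightarrow> nat set set \<Rightarrow> real mat" where
  "degree_matrix n E = mat_diag n (\<lambda>i. real (degree E i))"

text \<open>This is the inverse of the degree matrix whenever that inverse exists. An isolated
  vertex gets the entry \<open>1 / 0 = 0\<close>, which is multiplied by a zero column of the adjacency
  matrix anyway.\<close>

definition inv_degree_matrix :: "nat \<Rightarrow> nat set set \<Rightarrow> real mat" where
  "inv_degree_matrix n E = mat_diag n (\<lambda>i. 1 / real (degree E i))"

definition transition_matrix :: "nat \<Rightarrow> nat set set \<Rightarrow> real mat" where
  "transition_matrix n E = adjacency_matrix n E * inv_degree_matrix n E"

definition indicator_vec :: "nat \<Rightarrow> nat set \<Rightarrow> real vec" where
  "indicator_vec n \<Gamma> = vec n (\<lambda>i. if i \<in> \<Gamma> then 1 else 0)"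

definition walk_vec :: "nat \<Rightarrow> nat set set \<Rightarrow> nat set \<Rightarrow> nat \<Rightarrow> real vec" where
  "walk_vec n E \<Gamma> t =
     (transition_matrix n E ^\<^sub>m t) *\<^sub>v (degree_matrix n E *\<^sub>v indicator_vec n \<Gamma>)"

text \<open>\<open>\<Omega>\<close> is a set of indices of \<open>k\<close> largest entries of \<open>v\<close>. Ties may be broken in any way, and
  all indices are taken if \<open>k\<close> exceeds the dimension.\<close>

definition largest_entries :: "real vec \<Rightarrow> nat \<Rightarrow> nat set \<Rightarrow> bool" where
  "largest_entries v k \<Omega> \<longleftrightarrow>
     \<Omega> \<subseteq> {..<dim_vec v} \<and> card \<Omega> = min k (dim_vec v) \<and>
     (\<forall>i\<in>\<Omega>. \<forall>j\<in>{..<dim_vec v} - \<Omega>. v $ j \<le> v $ i)"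

definition rwt_output ::
  "nat \<Rightarrow> nat set set \<Rightarrow> real \<Rightarrow> nat set \<Rightarrow> real \<Rightarrow> nat \<Rightarrow> nat set \<Rightarrow> bool" where
  "rwt_output n E \<delta> \<Gamma> nhat t S \<longleftrightarrow>
     (\<exists>\<Omega>. largest_entries (walk_vec n E \<Gamma> t) (nat \<lfloor>(1 + \<delta>) * nhat\<rfloor>) \<Omega> \<and> S = \<Omega> \<union> \<Gamma>)"

section \<open>Computations with an operation count\<close>

text \<open>The cost model is the unit-cost real RAM. A value of type \<open>'a counted\<close> is the result of a
  computation together with the number of elementary operations it has executed. Programs are
  built from the unit-cost operations \<open>op\<close>, \<open>read\<close>, \<open>write\<close>, \<open>alloc\<close> by sequencing, branching on
  a computed truth value, and recursion; each recursive call and each loop iteration executes at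
  least one operation.\<close>

datatype 'a counted = Counted (result: 'a) (operations: nat)

definition bind_counted :: "'a counted \<Rightarrow> ('a \<Rightarrow> 'b counted) \<Rightarrow> 'b counted" where
  "bind_counted c f =
     Counted (result (f (result c))) (operations c + operations (f (result c)))"

adhoc_overloading Monad_Syntax.bind \<rightleftharpoons> bind_counted

definition return :: "'a \<Rightarrow> 'a counted" where
  "return x = Counted x 0"

text \<open>\<open>op\<close> charges one unit. It is only ever applied to the result of a single arithmetic
  operation or comparison on numbers, to a list constructor applied to computed values (one
  record being written), or to an existing number, truth value or reference being passed on.\<close>

definition op :: "'a \<Rightarrow> 'a counted" where
  "op x = Counted x 1"

text \<open>Termination proofs of recursive programs may use the values of intermediate results.\<close>

lemma bind_counted_cong [fundef_cong]:
  "c = c' \<Longrightarrow> (\<And>x. x = result c' \<Longrightarrow> f x = g x) \<Longrightarrow> bind_counted c f = bind_counted c' g"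
  by (simp add: bind_counted_def)

text \<open>An array is a block of memory cells. It has constant-time access; \<open>alloc\<close> does not
  initialise the cells. Writing is in place: the programs below thread every array that they
  modify linearly and never use a version that has been overwritten.\<close>

type_synonym 'a array = "nat \<Rightarrow> 'a"

definition alloc :: "'a array counted" where
  "alloc = op (\<lambda>_. undefined)"

definition read :: "'a array \<Rightarrow> nat \<Rightarrow> 'a counted" where
  "read a i = op (a i)"

definition "write" :: "'a array \<Rightarrow> nat \<Rightarrow> 'a \<Rightarrow> 'a array counted" where
  "write a i x = op (a(i := x))"

text \<open>The loops over \<open>0, \<dots>, k - 1\<close> and over a linked list, with loop state \<open>s\<close>. Each test for
  termination costs one operation.\<close>

primrec for_loop :: "nat \<Rightarrow> (nat \<Rightarrow> 's \<Rightarrow> 's counted) \<Rightarrow> 's \<Rightarrow> 's counted" where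
  "for_loop 0 body s = op s"
| "for_loop (Suc k) body s = do { s' \<leftarrow> for_loop k body s; s'' \<leftarrow> op s'; body k s'' }"

primrec foreach :: "'a list \<Rightarrow> ('a \<Rightarrow> 's \<Rightarrow> 's counted) \<Rightarrow> 's \<Rightarrow> 's counted" where
  "foreach [] body s = op s"
| "foreach (x # xs) body s = do { s' \<leftarrow> op s; s'' \<leftarrow> body x s'; foreach xs body s'' }"

section \<open>Random Walk Threshold as a program\<close>

text \<open>The graph is given by its adjacency lists, that is, by the positions of the nonzero entries
  in each row of the adjacency matrix. A dense matrix with its \<open>n * n\<close> entries could not even be
  read within the stated bound.\<close>

definition adjacency_lists :: "nat \<Rightarrow> nat set set \<Rightarrow> nat list array \<Rightarrow> bool" where
  "adjacency_lists n E adj \<longleftrightarrow> (\<forall>i<n. distinct (adj i) \<and> set (adj i) = {j. {i, j} \<in> E})"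

definition compute_degrees :: "nat \<Rightarrow> nat list array \<Rightarrow> real array counted" where
  "compute_degrees n adj = do {
     d \<leftarrow> alloc;
     for_loop n (\<lambda>i d. do {
       js \<leftarrow> read adj i;
       k \<leftarrow> foreach js (\<lambda>_ k. op (k + 1)) 0;
       write d i k }) d }"

text \<open>Row \<open>i\<close> of the transition matrix is stored as the list of its nonzero entries, each entry
  being a pair of a column index and a value.\<close>

definition compute_transition ::
  "nat \<Rightarrow> nat list array \<Rightarrow> real array \<Rightarrow> (nat \<times> real) list array counted" where
  "compute_transition n adj d = do {
     P \<leftarrow> alloc;
     for_loop n (\<lambda>i P. do {
       js \<leftarrow> read adj i;
       row \<leftarrow> foreach js (\<lambda>j row. do {
         dj \<leftarrow> read d j;
         p \<leftarrow> op (1 / dj);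
         op ((j, p) # row) }) [];
       write P i row }) P }"

definition compute_indicator :: "nat \<Rightarrow> nat list \<Rightarrow> real array counted" where
  "compute_indicator n seeds = do {
     b \<leftarrow> alloc;
     b \<leftarrow> for_loop n (\<lambda>i b. write b i 0) b;
     foreach seeds (\<lambda>i b. write b i 1) b }"

definition compute_start :: "nat \<Rightarrow> real array \<Rightarrow> real array \<Rightarrow> real array counted" where
  "compute_start n d b = do {
     v \<leftarrow> alloc;
     for_loop n (\<lambda>i v. do {
       di \<leftarrow> read d i;
       bi \<leftarrow> read b i;
       x \<leftarrow> op (di * bi);
       write v i x }) v }"

definition mult_transition ::
  "nat \<Rightarrow> (nat \<times> real) list array \<Rightarrow> real array \<Rightarrow> real array counted" where
  "mult_transition n P v = do {
     w \<leftarrow> alloc;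
     for_loop n (\<lambda>i w. do {
       row \<leftarrow> read P i;
       s \<leftarrow> foreach row (\<lambda>(j, p) s. do {
         x \<leftarrow> read v j;
         y \<leftarrow> op (p * x);
         op (s + y) }) 0;
       write w i s }) w }"

fun merge_desc :: "real array \<Rightarrow> nat list \<Rightarrow> nat list \<Rightarrow> nat list counted" where
  "merge_desc v [] ys = op ys"
| "merge_desc v (x # xs) [] = op (x # xs)"
| "merge_desc v (x # xs) (y # ys) = do {
     a \<leftarrow> read v x;
     b \<leftarrow> read v y;
     c \<leftarrow> op (b \<le> a);
     if c then do { zs \<leftarrow> merge_desc v xs (y # ys); op (x # zs) }
     else do { zs \<leftarrow> merge_desc v (x # xs) ys; op (y # zs) } }"

text \<open>Merge sort of the indices \<open>lo, \<dots>, lo + len - 1\<close> by descending entries of \<open>v\<close>.\<close>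

function sort_desc :: "real array \<Rightarrow> nat \<Rightarrow> nat \<Rightarrow> nat list counted" where
  "sort_desc v lo len = do {
     z \<leftarrow> op (len = 0);
     if z then op [] else do {
       u \<leftarrow> op (len = 1);
       if u then op [lo] else do {
         h \<leftarrow> op (len div 2);
         m \<leftarrow> op (lo + h);
         r \<leftarrow> op (len - h);
         xs \<leftarrow> sort_desc v lo h;
         ys \<leftarrow> sort_desc v m r;
         merge_desc v xs ys } } }"
  by pat_completeness auto
termination
  by (relation "measure (\<lambda>(v, lo, len). len)") (auto simp: op_def)

text \<open>The first \<open>\<lfloor>r\<rfloor>\<close> elements of a list, computed without a unit-cost floor operation.\<close>

fun take_real :: "real \<Rightarrow> nat list \<Rightarrow> nat list counted" where
  "take_real r [] = op []"
| "take_real r (x # xs) = do {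
     c \<leftarrow> op (1 \<le> r);
     if c then do { r' \<leftarrow> op (r - 1); ys \<leftarrow> take_real r' xs; op (x # ys) }
     else op [] }"

definition add_seeds :: "real array \<Rightarrow> nat list \<Rightarrow> nat list \<Rightarrow> nat list counted" where
  "add_seeds b seeds \<omega> = foreach \<omega> (\<lambda>i out. do {
     x \<leftarrow> read b i;
     c \<leftarrow> op (x = 0);
     if c then op (i # out) else return out }) seeds"

definition random_walk_threshold ::
  "nat \<Rightarrow> nat list array \<Rightarrow> real \<Rightarrow> nat list \<Rightarrow> real \<Rightarrow> nat \<Rightarrow> nat list counted" where
  "random_walk_threshold n adj \<delta> seeds nhat t = do {
     d \<leftarrow> compute_degrees n adj;
     P \<leftarrow> compute_transition n adj d;
     b \<leftarrow> compute_indicator n seeds;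
     v0 \<leftarrow> compute_start n d b;
     v \<leftarrow> for_loop t (\<lambda>_ v. mult_transition n P v) v0;
     is \<leftarrow> sort_desc v 0 n;
     f \<leftarrow> op (1 + \<delta>);
     r \<leftarrow> op (f * nhat);
     \<omega> \<leftarrow> take_real r is;
     add_seeds b seeds \<omega> }"

end

(* As row i of the transition matrix has degree(i) nonzero entries, one multiplication by it costs
   O(n * d_max); the t steps of the walk dominate the set-up, since E is nonempty and t is positive,
   whence n <= n * d_max * t. The remaining n * log n is the merge sort that selects the largest
   entries. *)

theory Submission
  imports Defs
begin

section \<open>Values and costs of primitive operations and loops\<close>

lemma result_simps [simp]:
  "result (bind_counted c f) = result (f (result c))"
  "result (op x) = x"
  "result (return x) = x"
  "result (read a i) = a i"
  "result (write a i x) = a(i := x)"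
  by (simp_all add: bind_counted_def op_def return_def read_def write_def)

lemma operations_simps [simp]:
  "operations (bind_counted c f) = operations c + operations (f (result c))"
  "operations (op x) = 1"
  "operations (return x) = 0"
  "operations (read a i) = 1"
  "operations (write a i x) = 1"
  "operations alloc = 1"
  by (simp_all add: bind_counted_def op_def return_def read_def write_def alloc_def)

text \<open>The additional unit per iteration is the loop test, and the final unit is the test that
  ends the loop. The bound on the body is required for every state, so that no loop invariant has to
  be carried along.\<close>

lemma operations_for_loop_le:
  assumes "\<And>i s. i < k \<Longrightarrow> operations (body i s) \<le> c"
  shows "operations (for_loop k body s) \<le> k * (c + 1) + 1"
  using assms
proof (induction k)
  case (Suc k)
  have "operations (for_loop k body s) \<le> k * (c + 1) + 1"
    using Suc by simp
  moreover have "operations (body k (result (for_loop k body s))) \<le> c"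
    using Suc.prems by simp
  ultimately show ?case by simp
qed simp

lemma operations_foreach_le:
  assumes "\<And>x s. x \<in> set xs \<Longrightarrow> operations (body x s) \<le> c"
  shows "operations (foreach xs body s) \<le> length xs * (c + 1) + 1"
  using assms
proof (induction xs arbitrary: s)
  case (Cons x xs)
  have "operations (foreach xs body (result (body x s))) \<le> length xs * (c + 1) + 1"
    using Cons by simp
  moreover have "operations (body x s) \<le> c"
    using Cons.prems by simp
  ultimately show ?case by simp
qed simp

lemma result_foreach: "result (foreach xs body s) = fold (\<lambda>x s. result (body x s)) xs s"
  by (induction xs arbitrary: s) simp_all

text \<open>Every pass that fills an array writes in iteration \<open>i\<close> only cell
  \<open>i\<close>, with a value independent of the array being filled, so the writes do not
  interact. Cells from \<open>k\<close> on keep the content of \<open>a\<close>, which is undefined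
  after \<open>alloc\<close>; hence the restriction to \<open>i < n\<close> in the results
  below.\<close>

lemma result_for_loop_update:
  assumes "\<And>i a. i < k \<Longrightarrow> result (body i a) = a(i := f i)"
  shows "result (for_loop k body a) = (\<lambda>i. if i < k then f i else a i)"
  using assms by (induction k) (auto simp: fun_eq_iff less_Suc_eq)

section \<open>The array passes: degrees, transition rows, seeds, start vector, one walk
  step\<close>

lemma result_compute_degrees:
  assumes "i < n"
  shows "result (compute_degrees n adj) i = real (length (adj i))"
proof -
  have *: "fold (\<lambda>x k. k + 1) js (c::real) = c + real (length js)" for c and js :: "nat list"
    by (induction js arbitrary: c) simp_all
  show ?thesis
    unfolding compute_degrees_def using assms
    by (simp add: result_for_loop_update[where f = "\<lambda>i. real (length (adj i))"]
        result_foreach *)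
qed

lemma operations_compute_degrees:
  assumes "\<And>i. i < n \<Longrightarrow> length (adj i) \<le> \<Delta>"
  shows "operations (compute_degrees n adj) \<le> n * (2 * \<Delta> + 4) + 2"
proof -
  have "operations (compute_degrees n adj) \<le> 1 + (n * ((2 * \<Delta> + 3) + 1) + 1)"
    unfolding compute_degrees_def operations_simps
  proof (intro add_mono operations_for_loop_le order_refl)
    fix i and a :: "real array"
    assume "i < n"
    have "operations (foreach (adj i) (\<lambda>_ k. op (k + 1)) (0::real)) \<le> length (adj i) * (1 + 1) + 1"
      by (rule operations_foreach_le) simp
    with assms[OF \<open>i < n\<close>]
    show "operations (read adj i \<bind> (\<lambda>js. foreach js (\<lambda>_ k. op (k + 1)) 0 \<bind> (\<lambda>k. write a i k)))
        \<le> 2 * \<Delta> + 3"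
      by simp
  qed
  then show ?thesis by (simp add: algebra_simps)
qed

text \<open>The reversal arises because entries are put at the front of the row. It is harmless, as
  rows are only summed over.\<close>

lemma result_compute_transition:
  assumes "i < n"
  shows "result (compute_transition n adj d) i = rev (map (\<lambda>j. (j, 1 / d j)) (adj i))"
proof -
  have *: "fold (\<lambda>j. (#) (j, 1 / d j)) js row = rev (map (\<lambda>j. (j, 1 / d j)) js) @ row" for js row
    by (induction js arbitrary: row) simp_all
  show ?thesis
    unfolding compute_transition_def using assms
    by (simp add: result_for_loop_update[where f = "\<lambda>i. rev (map (\<lambda>j. (j, 1 / d j)) (adj i))"]
        result_foreach *)
qed

lemma operations_compute_transition:
  assumes "\<And>i. i < n \<Longrightarrow> length (adj i) \<le> \<Delta>"
  shows "operations (compute_transition n adj d) \<le> n * (4 * \<Delta> + 4) + 2"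
proof -
  have "operations (compute_transition n adj d) \<le> 1 + (n * ((4 * \<Delta> + 3) + 1) + 1)"
    unfolding compute_transition_def operations_simps
  proof (intro add_mono operations_for_loop_le order_refl)
    fix i and a :: "(nat \<times> real) list array"
    assume "i < n"
    let ?body = "\<lambda>j row. read d j \<bind> (\<lambda>dj. op (1 / dj) \<bind> (\<lambda>p. op ((j, p) # row)))"
    have "operations (foreach (adj i) ?body []) \<le> length (adj i) * (3 + 1) + 1"
      by (rule operations_foreach_le) simp
    with assms[OF \<open>i < n\<close>]
    show "operations (read adj i \<bind> (\<lambda>js. foreach js ?body [] \<bind> (\<lambda>row. write a i row)))
        \<le> 4 * \<Delta> + 3"
      by simp
  qed
  then show ?thesis by (simp add: algebra_simps)
qed

lemma result_compute_indicator:
  assumes "i < n"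
  shows "result (compute_indicator n seeds) i = (if i \<in> set seeds then 1 else 0)"
proof -
  have *: "fold (\<lambda>i b. b(i := 1)) is b i = (if i \<in> set is then 1 else b i)"
    for "is" and b :: "real array" and i
    by (induction "is" arbitrary: b) auto
  show ?thesis
    unfolding compute_indicator_def using assms
    by (simp add: result_for_loop_update[where f = "\<lambda>_. 0"] result_foreach *)
qed

lemma operations_compute_indicator:
  "operations (compute_indicator n seeds) \<le> 2 * n + 2 * length seeds + 3"
proof -
  have zero: "operations (for_loop n (\<lambda>i b. write b i 0) a) \<le> n * (1 + 1) + 1" for a :: "real array"
    by (rule operations_for_loop_le) simp
  have one: "operations (foreach seeds (\<lambda>i b. write b i 1) a) \<le> length seeds * (1 + 1) + 1"
    for a :: "real array"
    by (rule operations_foreach_le) simp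
  show ?thesis
    unfolding compute_indicator_def operations_simps using add_mono[OF zero one]
    by (simp add: mult.commute[of _ 2] flip: mult_2)
qed

lemma result_compute_start:
  "i < n \<Longrightarrow> result (compute_start n d b) i = d i * b i"
  unfolding compute_start_def
  by (simp add: result_for_loop_update[where f = "\<lambda>i. d i * b i"])

lemma operations_compute_start: "operations (compute_start n d b) \<le> 5 * n + 2"
proof -
  have "operations (compute_start n d b) \<le> 1 + (n * (4 + 1) + 1)"
    unfolding compute_start_def operations_simps
    by (intro add_mono operations_for_loop_le order_refl) simp
  then show ?thesis by (simp add: algebra_simps)
qed

lemma result_mult_transition:
  assumes "i < n"
  shows "result (mult_transition n P v) i = (\<Sum>(j, p)\<leftarrow>P i. p * v j)"
proof -
  have *: "fold (\<lambda>x s. result ((case x of (j, p) \<Rightarrow> \<lambda>s. read v j \<bind>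
      (\<lambda>x. op (p * x) \<bind> (\<lambda>y. op (s + y)))) s)) row c = c + (\<Sum>(j, p)\<leftarrow>row. p * v j)" for row c
    by (induction row arbitrary: c) auto
  show ?thesis
    unfolding mult_transition_def using assms
    by (simp add: result_for_loop_update[where f = "\<lambda>i. \<Sum>(j, p)\<leftarrow>P i. p * v j"]
        result_foreach *)
qed

text \<open>Each stored entry costs a read, a product, a sum and a loop test. Each row adds four
  units: its read, the end of the inner loop, the write and the outer loop test. The values in
  \<open>v\<close> do not affect the cost.\<close>

lemma operations_mult_transition:
  assumes "\<And>i. i < n \<Longrightarrow> length (P i) \<le> \<Delta>"
  shows "operations (mult_transition n P v) \<le> n * (4 * \<Delta> + 4) + 2"
proof -
  have "operations (mult_transition n P v) \<le> 1 + (n * ((4 * \<Delta> + 3) + 1) + 1)"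
    unfolding mult_transition_def operations_simps
  proof (intro add_mono operations_for_loop_le order_refl)
    fix i and a :: "real array"
    assume "i < n"
    let ?body = "\<lambda>(j, p) s. read v j \<bind> (\<lambda>x. op (p * x) \<bind> (\<lambda>y. op (s + y)))"
    have "operations (foreach (P i) ?body 0) \<le> length (P i) * (3 + 1) + 1"
      by (rule operations_foreach_le) (simp split: prod.split)
    with assms[OF \<open>i < n\<close>]
    show "operations (read P i \<bind> (\<lambda>row. foreach row ?body 0 \<bind> (\<lambda>s. write a i s)))
        \<le> 4 * \<Delta> + 3"
      by simp
  qed
  then show ?thesis by (simp add: algebra_simps)
qed

section \<open>Merge sort by descending entries\<close>

lemma mset_merge_desc: "mset (result (merge_desc v xs ys)) = mset xs + mset ys"
  by (induction v xs ys rule: merge_desc.induct) simp_all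

lemma set_merge_desc: "set (result (merge_desc v xs ys)) = set xs \<union> set ys"
  by (metis mset_merge_desc set_mset_mset set_mset_union)

lemma sorted_merge_desc:
  assumes "sorted_wrt (\<lambda>i j. v j \<le> v i) xs" "sorted_wrt (\<lambda>i j. v j \<le> v i) ys"
  shows "sorted_wrt (\<lambda>i j. v j \<le> v i) (result (merge_desc v xs ys))"
  using assms by (induction v xs ys rule: merge_desc.induct) (auto simp: set_merge_desc)

text \<open>Two reads, a comparison and a list constructor are charged to the one element that is
  emitted; the last unit is for the base case.\<close>

lemma operations_merge_desc:
  "operations (merge_desc v xs ys) \<le> 4 * (length xs + length ys) + 1"
  by (induction v xs ys rule: merge_desc.induct) simp_all

declare sort_desc.simps [simp del]

lemma mset_sort_desc: "mset (result (sort_desc v lo len)) = mset [lo..<lo + len]"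
proof (induction len arbitrary: lo rule: less_induct)
  case (less len)
  \<comment> \<open>The upper half is written with length \<open>len - len div 2\<close> so that it
    has the form of the second recursive call.\<close>
  have "[lo..<lo + len] = [lo..<lo + len div 2] @ [lo + len div 2..<lo + len div 2 + (len - len div 2)]"
    using upt_add_eq_append[of lo "lo + len div 2" "len - len div 2"] by simp
  with less show ?case
    by (subst sort_desc.simps) (auto simp: mset_merge_desc)
qed

lemma sorted_sort_desc: "sorted_wrt (\<lambda>i j. v j \<le> v i) (result (sort_desc v lo len))"
proof (induction len arbitrary: lo rule: less_induct)
  case (less len)
  then show ?case
    by (subst sort_desc.simps) (auto intro!: sorted_merge_desc)
qed

text \<open>Both halves have length at most \<open>2 * len / 3\<close>, so that each level of the recursion gains
  \<open>len * ln (3 / 2) \<ge> len / 3\<close>. The summand \<open>9 * len - 6\<close> pays for the leaves and for the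
  constant overhead of the inner nodes.\<close>

lemma operations_sort_desc:
  "len \<ge> 1 \<Longrightarrow> real (operations (sort_desc v lo len)) \<le> 12 * real len * ln (real len) + 9 * real len - 6"
proof (induction len arbitrary: lo rule: less_induct)
  case (less len)
  show ?case
  proof (cases "len = 1")
    case True
    then show ?thesis by (subst sort_desc.simps) simp
  next
    case False
    with less.prems have len: "len \<ge> 2" by simp
    define h r where "h = len div 2" and "r = len - h"
    \<comment> \<open>The factor 2/3 is attained at \<open>len = 3\<close>, where the larger half
      has length 2.\<close>
    have hr: "1 \<le> h" "h < len" "1 \<le> r" "r < len" "h + r = len" "3 * h \<le> 2 * len" "3 * r \<le> 2 * len"
      using len unfolding h_def r_def by linarith+
    define xs ys where "xs = result (sort_desc v lo h)" and "ys = result (sort_desc v (lo + h) r)"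
    have lengths: "length xs = h" "length ys = r"
      unfolding xs_def ys_def by (metis mset_sort_desc size_mset length_upt add_diff_cancel_left')+
    have part: "real k * ln (real k) \<le> real k * (ln (real len) - 1 / 3)"
      if "1 \<le> k" "3 * k \<le> 2 * len" for k
    proof -
      \<comment> \<open>This is \<open>ln x \<le> x - 1\<close> at \<open>x = 2 / 3\<close>,
        negated.\<close>
      have "1 / 3 \<le> ln (3 / 2 :: real)"
        using ln_le_minus_one[of "2 / 3 :: real"] by (simp add: ln_div)
      moreover have "ln (real k) \<le> ln (real len / (3 / 2))"
        using that len by (subst ln_le_cancel_iff) (simp_all add: field_simps flip: of_nat_mult)
      moreover have "ln (real len / (3 / 2)) = ln (real len) - ln (3 / 2)"
        using len by (subst ln_div) simp_all
      ultimately have "ln (real k) \<le> ln (real len) - 1 / 3"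
        by linarith
      then show ?thesis by (intro mult_left_mono) simp_all
    qed
    have "operations (sort_desc v lo len) =
        5 + operations (sort_desc v lo h) + operations (sort_desc v (lo + h) r)
          + operations (merge_desc v xs ys)"
      using len by (subst sort_desc.simps) (simp add: h_def r_def xs_def ys_def)
    also have "\<dots> \<le> 6 + operations (sort_desc v lo h) + operations (sort_desc v (lo + h) r) + 4 * len"
      using operations_merge_desc[of v xs ys] hr(5) by (simp add: lengths)
    finally have "real (operations (sort_desc v lo len)) \<le>
        6 + real (operations (sort_desc v lo h)) + real (operations (sort_desc v (lo + h) r)) + 4 * real len"
      by linarith
    \<comment> \<open>The 6 collects the five operations of the node and the constant of the merge.
      It cancels one of the two summands -6 from the induction hypotheses, and the other one
      survives as the -6 of the claim. The merge cost \<open>4 * len\<close> is cancelled below by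
      the gain \<open>12 * len / 3\<close>.\<close>
    also have "\<dots> \<le> 6 + (12 * (real h * ln (real h)) + 9 * real h - 6)
        + (12 * (real r * ln (real r)) + 9 * real r - 6) + 4 * real len"
      using less.IH[OF hr(2,1), of lo] less.IH[OF hr(4,3), of "lo + h"] by simp
    also have "\<dots> \<le> 12 * (real h * (ln (real len) - 1 / 3) + real r * (ln (real len) - 1 / 3))
        + 9 * (real h + real r) - 6 + 4 * real len"
      using part[OF hr(1,6)] part[OF hr(3,7)] by simp
    also have "\<dots> = 12 * (real h + real r) * (ln (real len) - 1 / 3)
        + 9 * (real h + real r) - 6 + 4 * real len"
      by (simp add: algebra_simps)
    also have "real h + real r = real len"
      using hr(5) by linarith
    finally show ?thesis by (simp add: algebra_simps)
  qed
qed

section \<open>Selecting the largest entries and adding the seeds\<close>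

lemma result_take_real: "result (take_real r xs) = take (nat \<lfloor>r\<rfloor>) xs"
proof (induction r xs rule: take_real.induct)
  case (2 r x xs)
  have "nat \<lfloor>r\<rfloor> = Suc (nat \<lfloor>r - 1\<rfloor>)" if "1 \<le> r"
    using that by linarith
  \<comment> \<open>This includes negative \<open>r\<close>, where \<open>nat\<close> truncates to 0
    and the program also stops at once.\<close>
  moreover have "nat \<lfloor>r\<rfloor> = 0" if "\<not> 1 \<le> r"
    using that by linarith
  ultimately show ?case using 2 by simp
qed simp

lemma operations_take_real: "operations (take_real r xs) \<le> 3 * length xs + 2"
  by (induction r xs rule: take_real.induct) auto

text \<open>The indicator array serves as a constant-time membership test: an index that is skipped
  is a seed and already in the initial accumulator. The assumption concerns only indices in
  \<open>\<omega>\<close>, because the array is not initialised everywhere.\<close>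

lemma set_result_add_seeds:
  assumes "\<And>i. i \<in> set \<omega> \<Longrightarrow> b i = 0 \<longleftrightarrow> i \<notin> set seeds"
  shows "set (result (add_seeds b seeds \<omega>)) = set \<omega> \<union> set seeds"
proof -
  have "set (fold (\<lambda>i out. result (if b i = 0 then op (i # out) else return out)) \<omega> out)
      = {i \<in> set \<omega>. b i = 0} \<union> set out" for out
    by (induction \<omega> arbitrary: out) auto
  then show ?thesis
    unfolding add_seeds_def using assms by (auto simp: result_foreach)
qed

lemma operations_add_seeds: "operations (add_seeds b seeds \<omega>) \<le> 4 * length \<omega> + 1"
proof -
  have "operations (add_seeds b seeds \<omega>) \<le> length \<omega> * (3 + 1) + 1"
    unfolding add_seeds_def by (rule operations_foreach_le) simp
  then show ?thesis by (simp add: algebra_simps)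
qed

text \<open>In a sorted list, each element of a prefix dominates each element of the remaining
  suffix. Since the list is a permutation of all indices, the suffix contains every index that was
  not selected.\<close>

lemma largest_entries_take:
  assumes "sorted_wrt (\<lambda>i j. f j \<le> f i) is" "mset is = mset [0..<n]"
  shows "largest_entries (vec n f) k (set (take k is))"
proof -
  have dist: "distinct is" and set: "set is = {..<n}" and len: "length is = n"
    using mset_eq_imp_distinct_iff[OF assms(2)] mset_eq_setD[OF assms(2)] mset_eq_length[OF assms(2)]
    by (auto simp: atLeast0LessThan)
  have split: "sorted_wrt (\<lambda>i j. f j \<le> f i) (take k is @ drop k is)"
    using assms(1) by simp
  have "card (set (take k is)) = min k n"
    using dist len by (simp add: distinct_card min.commute)
  moreover have "set (take k is) \<subseteq> {..<n}"
    using set set_take_subset by fast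
  moreover have "f j \<le> f i" if "i \<in> set (take k is)" "j \<in> {..<n} - set (take k is)" for i j
  proof -
    have "j \<in> set (drop k is)"
      using that(2) set by (metis Diff_iff Un_iff append_take_drop_id set_append)
    with that(1) split show ?thesis
      unfolding sorted_wrt_append by blast
  qed
  ultimately show ?thesis
    unfolding largest_entries_def by (auto simp: subset_eq)
qed

text \<open>The recursion of \<open>pow_mat\<close> puts the new factor on the right, whereas the
  walk loop applies its last step on the left. Generalising over \<open>x\<close> lets the induction
  move a factor across.\<close>

lemma pow_mat_Suc_mult_vec:
  assumes "A \<in> carrier_mat n n" "x \<in> carrier_vec n"
  shows "(A ^\<^sub>m Suc k) *\<^sub>v x = A *\<^sub>v ((A ^\<^sub>m k) *\<^sub>v x)"
  using assms(2)
proof (induction k arbitrary: x)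
  case (Suc k)
  have "(A ^\<^sub>m Suc (Suc k)) *\<^sub>v x = (A ^\<^sub>m Suc k) *\<^sub>v (A *\<^sub>v x)"
    using assms(1) Suc.prems by (subst pow_mat.simps) (rule assoc_mult_mat_vec, auto)
  also have "\<dots> = A *\<^sub>v ((A ^\<^sub>m k) *\<^sub>v (A *\<^sub>v x))"
    using Suc assms(1) by auto
  also have "(A ^\<^sub>m k) *\<^sub>v (A *\<^sub>v x) = (A ^\<^sub>m Suc k) *\<^sub>v x"
    using assms(1) Suc.prems by (subst pow_mat.simps) (rule assoc_mult_mat_vec[symmetric], auto)
  finally show ?case .
qed (use assms in auto)

section \<open>Agreement of the program with the matrix specification\<close>

locale graph_input =
  fixes n :: nat and E :: "nat set set" and adj :: "nat list array"
  assumes graph: "simple_graph n E" and nonempty: "E \<noteq> {}" and adj: "adjacency_lists n E adj"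
begin

lemma edge_less: "{i, j} \<in> E \<Longrightarrow> i < n \<and> j < n"
  using graph unfolding simple_graph_def by (fastforce simp: doubleton_eq_iff)

lemma length_adj: "i < n \<Longrightarrow> length (adj i) = degree E i"
  using adj unfolding adjacency_lists_def degree_def by (metis distinct_card)

lemma length_adj_le: "i < n \<Longrightarrow> length (adj i) \<le> max_degree n E"
  unfolding max_degree_def by (simp add: length_adj)

text \<open>An endpoint of an edge is a vertex with a nonempty adjacency list. Positivity lets
  \<open>n * d_max * t\<close> absorb the lower-order terms; for a single vertex without edges the
  claimed bound would be 0.\<close>

lemma n_pos: "0 < n" and max_degree_pos: "0 < max_degree n E"
proof -
  obtain u v where uv: "{u, v} \<in> E"
    using nonempty graph unfolding simple_graph_def by blast
  then have "u < n" using edge_less by blast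
  then show "0 < n" by simp
  have "v \<in> set (adj u)"
    using adj uv \<open>u < n\<close> unfolding adjacency_lists_def by blast
  then have "0 < length (adj u)" by (rule length_pos_if_in_set)
  then show "0 < max_degree n E"
    using length_adj_le[OF \<open>u < n\<close>] by linarith
qed

definition "d = result (compute_degrees n adj)"
definition "P = result (compute_transition n adj d)"

lemma d_eq: "i < n \<Longrightarrow> d i = real (degree E i)"
  by (simp add: d_def result_compute_degrees length_adj)

lemma transition_matrix_carrier [simp]: "transition_matrix n E \<in> carrier_mat n n"
  unfolding transition_matrix_def adjacency_matrix_def inv_degree_matrix_def
  by (intro mult_carrier_mat[of _ n n]) auto

lemma transition_matrix_index:
  assumes "i < n" "j < n"
  shows "transition_matrix n E $$ (i, j) = (if {i, j} \<in> E then 1 / real (degree E j) else 0)"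
  unfolding transition_matrix_def inv_degree_matrix_def using assms
  by (subst mat_diag_mult_right[where nr = n]) (auto simp: adjacency_matrix_def)

text \<open>An array is a function on all naturals, and \<open>vec n\<close> keeps just the cells
  that represent vertices. The sparse row sum is the full one with its zero terms left out.\<close>

lemma mult_transition_vec:
  "vec n (result (mult_transition n P v)) = transition_matrix n E *\<^sub>v vec n v"
proof (rule eq_vecI)
  fix i
  assume "i < dim_vec (transition_matrix n E *\<^sub>v vec n v)"
  then have i: "i < n" using transition_matrix_carrier by simp
  have dist: "distinct (adj i)" and set: "set (adj i) = {j. {i, j} \<in> E}"
    using adj i unfolding adjacency_lists_def by auto
  have "result (mult_transition n P v) i = (\<Sum>j\<leftarrow>adj i. 1 / d j * v j)"
    using i by (simp add: result_mult_transition P_def result_compute_transition o_def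
        sum_list_rev flip: rev_map)
  also have "\<dots> = (\<Sum>j | {i, j} \<in> E. 1 / d j * v j)"
    using dist set by (simp add: sum_list_distinct_conv_sum_set)
  \<comment> \<open>Neighbours are below \<open>n\<close> by \<open>edge_less\<close>, so passing to
    all vertices adds only zeros.\<close>
  also have "\<dots> = (\<Sum>j\<in>{0..<n}. if {i, j} \<in> E then 1 / d j * v j else 0)"
    using edge_less by (intro sum.mono_neutral_cong_left) auto
  also have "\<dots> = (\<Sum>j\<in>{0..<n}. transition_matrix n E $$ (i, j) * v j)"
    using i by (intro sum.cong) (auto simp: transition_matrix_index d_eq)
  also have "\<dots> = (transition_matrix n E *\<^sub>v vec n v) $ i"
    using i carrier_matD[OF transition_matrix_carrier] by (simp add: scalar_prod_def)
  finally show "vec n (result (mult_transition n P v)) $ i = (transition_matrix n E *\<^sub>v vec n v) $ i"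
    using i by simp
qed (use carrier_matD[OF transition_matrix_carrier] in simp)

lemma walk_loop_vec:
  "vec n (result (for_loop t (\<lambda>_ v. mult_transition n P v) v))
    = (transition_matrix n E ^\<^sub>m t) *\<^sub>v vec n v"
proof (induction t)
  case (Suc t)
  then show ?case
    by (simp add: mult_transition_vec pow_mat_Suc_mult_vec[where n = n] del: pow_mat.simps)
next
  case 0
  have "dim_row (transition_matrix n E) = n"
    using transition_matrix_carrier by blast
  then show ?case by simp
qed

lemma start_vec:
  "vec n (result (compute_start n d (result (compute_indicator n seeds))))
    = degree_matrix n E *\<^sub>v indicator_vec n (set seeds)"
proof (rule eq_vecI)
  fix i
  assume "i < dim_vec (degree_matrix n E *\<^sub>v indicator_vec n (set seeds))"
  then have i: "i < n" by (simp add: degree_matrix_def mat_diag_def)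
  have "(degree_matrix n E *\<^sub>v indicator_vec n (set seeds)) $ i
      = (\<Sum>j\<in>{0..<n}. (if i = j then real (degree E j) else 0) * (if j \<in> set seeds then 1 else 0))"
    using i by (simp add: degree_matrix_def mat_diag_def indicator_vec_def scalar_prod_def)
  also have "\<dots> = (\<Sum>j\<in>{0..<n}. if i = j then real (degree E j) * (if j \<in> set seeds then 1 else 0) else 0)"
    by (intro sum.cong) auto
  also have "\<dots> = real (degree E i) * (if i \<in> set seeds then 1 else 0)"
    using i by simp
  finally show "vec n (result (compute_start n d (result (compute_indicator n seeds)))) $ i
      = (degree_matrix n E *\<^sub>v indicator_vec n (set seeds)) $ i"
    using i by (simp add: result_compute_start d_eq result_compute_indicator)
qed (simp add: degree_matrix_def mat_diag_def)

lemma rwt_output_result: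
  assumes "set seeds \<subseteq> {..<n}"
  shows "rwt_output n E \<delta> (set seeds) nhat t (set (result (random_walk_threshold n adj \<delta> seeds nhat t)))"
proof -
  define b where "b = result (compute_indicator n seeds)"
  define v where "v = result (for_loop t (\<lambda>_ v. mult_transition n P v) (result (compute_start n d b)))"
  define \<omega> where "\<omega> = take (nat \<lfloor>(1 + \<delta>) * nhat\<rfloor>) (result (sort_desc v 0 n))"
  have "vec n v = walk_vec n E (set seeds) t"
    unfolding v_def b_def walk_loop_vec start_vec walk_vec_def ..
  then have "largest_entries (walk_vec n E (set seeds) t) (nat \<lfloor>(1 + \<delta>) * nhat\<rfloor>) (set \<omega>)"
    unfolding \<omega>_def using largest_entries_take[OF sorted_sort_desc, of v 0 n n] mset_sort_desc
    by (metis add_0)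
  moreover have "set \<omega> \<subseteq> {..<n}"
    using calculation unfolding largest_entries_def walk_vec_def using transition_matrix_carrier
    by (metis \<open>vec n v = walk_vec n E (set seeds) t\<close> dim_vec walk_vec_def)
  then have "set (result (add_seeds b seeds \<omega>)) = set \<omega> \<union> set seeds"
    by (intro set_result_add_seeds) (auto simp: b_def result_compute_indicator)
  moreover have "result (random_walk_threshold n adj \<delta> seeds nhat t) = result (add_seeds b seeds \<omega>)"
    unfolding random_walk_threshold_def
    by (simp add: result_take_real \<omega>_def v_def b_def P_def d_def)
  ultimately show ?thesis
    unfolding rwt_output_def by auto
qed

section \<open>The total operation count\<close>

lemma operations_le:
  assumes "distinct seeds" "set seeds \<subseteq> {..<n}" "0 < t"
  shows "real (operations (random_walk_threshold n adj \<delta> seeds nhat t))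
    \<le> 100 * (real n * real (max_degree n E) * real t + real n * ln (real n))"
proof -
  let ?\<Delta> = "max_degree n E"
  define b where "b = result (compute_indicator n seeds)"
  define v0 where "v0 = result (compute_start n d b)"
  define walk where "walk = for_loop t (\<lambda>_ v. mult_transition n P v) v0"
  define v where "v = result walk"
  define sorted where "sorted = result (sort_desc v 0 n)"
  define \<omega> where "\<omega> = result (take_real ((1 + \<delta>) * nhat) sorted)"
  \<comment> \<open>Distinctness matters here: a seed list with repetitions could be arbitrarily
    long.\<close>
  have seeds: "length seeds \<le> n"
    using assms(1,2) by (metis card_lessThan card_mono distinct_card finite_lessThan)
  have sorted: "length sorted = n"
    unfolding sorted_def by (metis mset_sort_desc size_mset length_upt add_diff_cancel_left')
  have \<omega>: "length \<omega> \<le> n"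
    unfolding \<omega>_def result_take_real by (simp add: sorted)
  have P: "length (P i) \<le> ?\<Delta>" if "i < n" for i
    using that by (simp add: P_def result_compute_transition length_adj_le)
  have walk: "operations walk \<le> t * (n * (4 * ?\<Delta> + 4) + 2 + 1) + 1"
    unfolding walk_def by (intro operations_for_loop_le operations_mult_transition P)
  have "operations (random_walk_threshold n adj \<delta> seeds nhat t) =
      operations (compute_degrees n adj) + operations (compute_transition n adj d)
      + operations (compute_indicator n seeds) + operations (compute_start n d b)
      + operations walk + operations (sort_desc v 0 n) + 2
      + operations (take_real ((1 + \<delta>) * nhat) sorted) + operations (add_seeds b seeds \<omega>)"
    unfolding random_walk_threshold_def
    by (simp add: \<omega>_def sorted_def v_def walk_def v0_def b_def P_def d_def)
  also have "\<dots> \<le> (n * (2 * ?\<Delta> + 4) + 2) + (n * (4 * ?\<Delta> + 4) + 2) + (4 * n + 3) + (5 * n + 2)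
      + (t * (n * (4 * ?\<Delta> + 4) + 2 + 1) + 1) + operations (sort_desc v 0 n) + 2
      + (3 * n + 2) + (4 * n + 1)"
    using operations_compute_degrees[of n adj, OF length_adj_le]
      operations_compute_transition[of n adj, OF length_adj_le]
      operations_compute_indicator[of n seeds] operations_compute_start[of n d b]
      walk operations_take_real[of "(1 + \<delta>) * nhat" sorted] operations_add_seeds[of b seeds \<omega>]
      seeds sorted \<omega>
    by (intro add_mono) auto
  also have "\<dots> = 6 * (n * ?\<Delta>) + 4 * (n * ?\<Delta> * t) + 4 * (n * t) + 3 * t + 24 * n + 15
      + operations (sort_desc v 0 n)"
    by (simp add: algebra_simps)
  \<comment> \<open>As \<open>n\<close>, the maximal degree and \<open>t\<close> are at least 1,
    each monomial, including the constant, is at most their product. The coefficients add up to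
    56.\<close>
  also have "\<dots> \<le> 6 * (n * ?\<Delta> * t) + 4 * (n * ?\<Delta> * t) + 4 * (n * ?\<Delta> * t) + 3 * (n * ?\<Delta> * t)
      + 24 * (n * ?\<Delta> * t) + 15 * (n * ?\<Delta> * t) + operations (sort_desc v 0 n)"
    using n_pos max_degree_pos assms(3) by (intro add_mono mult_left_mono) auto
  finally have "real (operations (random_walk_threshold n adj \<delta> seeds nhat t))
      \<le> 56 * real (n * ?\<Delta> * t) + real (operations (sort_desc v 0 n))"
    by linarith
  also have "\<dots> \<le> 56 * real (n * ?\<Delta> * t) + (12 * real n * ln (real n) + 9 * real n - 6)"
    using operations_sort_desc[of n v 0] n_pos by simp
  \<comment> \<open>The linear term \<open>9 * n\<close> of the sorting bound also goes into the
    product, giving 56 + 9.\<close>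
  also have "\<dots> \<le> 65 * real (n * ?\<Delta> * t) + 12 * (real n * ln (real n))"
  proof -
    have "n \<le> n * ?\<Delta> * t"
      using max_degree_pos assms(3) by simp
    then have "real n \<le> real (n * ?\<Delta> * t)" by (rule of_nat_mono)
    then show ?thesis by linarith
  qed
  \<comment> \<open>Both 65 and 12 are rounded up to 100; for the second this requires
    \<open>n * ln n\<close> to be nonnegative, which holds as \<open>n\<close> is at least
    1.\<close>
  also have "\<dots> \<le> 100 * (real n * real ?\<Delta> * real t + real n * ln (real n))"
  proof -
    have "0 \<le> real n * ln (real n)" using n_pos by simp
    then show ?thesis by simp
  qed
  finally show ?thesis .
qed

end

theorem theorem4p1:
  shows "\<exists>C::real. \<forall>(n::nat) (E::nat set set) (C\<^sub>1::nat set) (\<Gamma>::nat set) (\<delta>::real) (nhat::real) (t::nat)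
           (adj::nat list array) (seeds::nat list).
     simple_graph n E \<and> E \<noteq> {} \<and> 0 < \<delta> \<and> \<delta> < 1 \<and> \<Gamma> \<subseteq> C\<^sub>1 \<and> C\<^sub>1 \<subseteq> {..<n} \<and> 0 < t \<and>
     adjacency_lists n E adj \<and> distinct seeds \<and> set seeds = \<Gamma> \<longrightarrow>
       rwt_output n E \<delta> \<Gamma> nhat t (set (result (random_walk_threshold n adj \<delta> seeds nhat t))) \<and>
       real (operations (random_walk_threshold n adj \<delta> seeds nhat t))
         \<le> C * (real n * real (max_degree n E) * real t + real n * ln (real n))"
proof (intro exI[of _ 100] allI impI, elim conjE, intro conjI)
  fix n :: nat and E :: "nat set set" and C\<^sub>1 \<Gamma> :: "nat set" and \<delta> nhat :: real and t :: nat
    and adj :: "nat list array" and seeds :: "nat list"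
  assume "simple_graph n E" "E \<noteq> {}" "adjacency_lists n E adj"
  then interpret graph_input n E adj by unfold_locales
  assume "\<Gamma> \<subseteq> C\<^sub>1" "C\<^sub>1 \<subseteq> {..<n}" "set seeds = \<Gamma>"
  then have seeds: "set seeds \<subseteq> {..<n}" by simp
  show "rwt_output n E \<delta> \<Gamma> nhat t (set (result (random_walk_threshold n adj \<delta> seeds nhat t)))"
    using rwt_output_result[OF seeds] \<open>set seeds = \<Gamma>\<close> by simp
  assume "distinct seeds" "0 < t"
  then show "real (operations (random_walk_threshold n adj \<delta> seeds nhat t))
      \<le> 100 * (real n * real (max_degree n E) * real t + real n * ln (real n))"
    using seeds by (intro operations_le)
qed

end
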